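(* Let $k\ge 1$ be an integer. If $f:\mathbb{R}\to\mathbb{R}$ is locally integrable, $h>0$, and $$\int_{jh}^{(j+1)h} f(u)\,du = 0 \qquad \text{for all } j\in\mathbb{Z},$$ then $$\|f\| \le W^*_{2k}\,\omega_{2k}(f,h),$$ where the (best possible) constant $W^*_{2k}$ satisfies $$\frac{1}{\binom{2k}{k}} \le W^*_{2k} \le \frac{1+H_k}{\binom{2k}{k}}, \qquad H_k := \sum_{j=1}^k \frac1j .$$
   Context: Functions are defined at every point of $\mathbb{R}$ and are not identified when they agree almost everywhere. The norm is the pointwise supremum $\|f\| := \sup_{x\in\mathbb{R}} |f(x)|$ (not an essential supremum). For an integer $m\ge 1$ and $t\in\mathbb{R}$, the symmetric difference is $$\Delta_t^m f(x) := \sum_{j=0}^m (-1)^j \binom{m}{j} f\bigl(x+(j-m/2)t\bigr),$$ and the modulus of smoothness is $$\omega_{2k}(f,h) := \sup_{|t|\le h} \|\Delta_t^{2k} f(\cdot)\| \in [0,\infty].$$ If $\omega_{2k}(f,h)=\infty$, the inequality $\|f\|\le W\,\omega_{2k}(f,h)$ is regarded as trivially satisfied. The constant $W^*_{2k}$ is the smallest constant $W>0$, depending only on $k$, such that $\|f\| \le W\,\omega_{2k}(f,h)$ holds for every $h>0$ and every locally integrable $f:\mathbb{R}\to\mathbb{R}$ with $\int_{jh}^{(j+1)h} f(u)\,du=0$ for all $j\in\mathbb{Z}$. *)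

theory Defs
  imports "HOL-Analysis.Analysis"
begin

definition sup_norm :: "(real \<Rightarrow> real) \<Rightarrow> ennreal" where
  "sup_norm f = (SUP x. ennreal \<bar>f x\<bar>)"

definition symm_diff :: "nat \<Rightarrow> real \<Rightarrow> (real \<Rightarrow> real) \<Rightarrow> real \<Rightarrow> real" where
  "symm_diff m t f x =
     (\<Sum>j=0..m. (- 1) ^ j * real (m choose j) * f (x + (real j - real m / 2) * t))"

definition modulus_of_smoothness :: "nat \<Rightarrow> (real \<Rightarrow> real) \<Rightarrow> real \<Rightarrow> ennreal" where
  "modulus_of_smoothness m f h = (SUP t\<in>{t. \<bar>t\<bar> \<le> h}. sup_norm (symm_diff m t f))"

definition locally_integrable :: "(real \<Rightarrow> real) \<Rightarrow> bool" where
  "locally_integrable f \<longleftrightarrow> (\<forall>K. compact K \<longrightarrow> set_integrable lebesgue K f)"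

definition zero_means :: "(real \<Rightarrow> real) \<Rightarrow> real \<Rightarrow> bool" where
  "zero_means f h \<longleftrightarrow>
     (\<forall>j::int. (LINT u:{of_int j * h..(of_int j + 1) * h}|lebesgue. f u) = 0)"

(* Since W > 0, the right-hand side is \<infinity> whenever the modulus is, so that case imposes
   no condition on W. *)
definition Whitney_constant :: "nat \<Rightarrow> real \<Rightarrow> bool" where
  "Whitney_constant k W \<longleftrightarrow> W > 0 \<and>
     (\<forall>h f. h > 0 \<and> locally_integrable f \<and> zero_means f h \<longrightarrow>
        sup_norm f \<le> ennreal W * modulus_of_smoothness (2 * k) f h)"

(* LEAST is a definite description: this value is meaningful only once a least
   constant is known to exist. *)
definition best_Whitney_constant :: "nat \<Rightarrow> real" where
  "best_Whitney_constant k = (LEAST W. Whitney_constant k W)"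

end

(* Write C for the central binomial coefficient, M for the modulus of smoothness and F for the
   primitive of f, which vanishes on the lattice h Z. Isolating the central term of the difference
   at x and averaging over steps t in [0,h] bounds C |f x| by M plus a combination of the values
   F(x + ih) - F(x - ih) with weights at most C/(ih). Since C |F| \<le> M h / 2, that
   combination is at most H_k M. The bound on F comes from averaging the difference along a segment
   in (centre, step) space that takes every node from a lattice point to x, so that each integral
   is a multiple of F(x); the resulting alternating sum of reciprocals is estimated termwise.
   The lower bound comes from the indicator function of a point, whose lattice-cell
   integrals vanish although its supremum norm does not. *)

theory Submission imports Defs begin

section \<open>Alternating sums and the even symmetric difference\<close>

text \<open>Splitting off the first term leaves \<open>b 0\<close> minus the alternating sum of the
  shifted sequence, which lies between 0 and \<open>b 1\<close> by induction over all
  sequences.\<close>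

lemma alternating_sum_bounds:
  fixes b :: "nat \<Rightarrow> real"
  assumes "\<And>i. b (Suc i) \<le> b i" and "\<And>i. 0 \<le> b i"
  shows "0 \<le> (\<Sum>i<n. (-1) ^ i * b i) \<and> (\<Sum>i<n. (-1) ^ i * b i) \<le> b 0"
  using assms
proof (induction n arbitrary: b)
  case (Suc n)
  have "(\<Sum>i<Suc n. (-1) ^ i * b i) = b 0 - (\<Sum>i<n. (-1) ^ i * b (Suc i))"
    by (simp add: sum.lessThan_Suc_shift sum_negf del: sum.lessThan_Suc)
  moreover have "0 \<le> (\<Sum>i<n. (-1) ^ i * b (Suc i)) \<and> (\<Sum>i<n. (-1) ^ i * b (Suc i)) \<le> b (Suc 0)"
    by (rule Suc.IH[of "\<lambda>i. b (Suc i)"]) (use Suc.prems in auto)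
  ultimately show ?case
    using Suc.prems(1)[of 0] by simp
qed auto

lemma sum_symmetric:
  fixes g :: "nat \<Rightarrow> real"
  shows "(\<Sum>j=0..2*k. g j) = g k + (\<Sum>i=1..k. g (k + i) + g (k - i))"
proof -
  have "{0..2*k} = insert k ({0..<k} \<union> {k<..2*k})"
    by auto
  moreover have "sum g ({0..<k} \<union> {k<..2*k}) = sum g {0..<k} + sum g {k<..2*k}"
    by (rule sum.union_disjoint) auto
  ultimately have "sum g {0..2*k} = sum g {0..<k} + g k + sum g {k<..2*k}"
    by simp
  moreover have "sum g {0..<k} = (\<Sum>i=1..k. g (k - i))"
    by (rule sum.reindex_bij_witness[of _ "\<lambda>i. k - i" "\<lambda>i. k - i"]) auto
  moreover have "sum g {k<..2*k} = (\<Sum>i=1..k. g (k + i))"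
    by (rule sum.reindex_bij_witness[of _ "\<lambda>i. k + i" "\<lambda>i. i - k"]) auto
  ultimately show ?thesis
    by (simp add: sum.distrib)
qed

text \<open>Once \<open>k + Suc i\<close> exceeds \<open>2 * k\<close> the left side is 0, so the
  decrease continues over all of \<open>nat\<close>, as \<open>alternating_sum_bounds\<close> asks
  of its sequence.\<close>

lemma binomial_central_antimono:
  "(2 * k) choose (k + Suc i) \<le> (2 * k) choose (k + i)"
proof (cases "Suc i \<le> k")
  case True
  then show ?thesis
    by (intro binomial_antimono) auto
qed (simp add: binomial_eq_0)

text \<open>The nodes \<open>k + i\<close> and \<open>k - i\<close> are mirror images about
  \<open>x\<close> with equal coefficients and equal signs. This form isolates the central
  term.\<close>

lemma symm_diff_even:
  "symm_diff (2 * k) t f x = (-1) ^ k * (real (2 * k choose k) * f x +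
     (\<Sum>i=1..k. (-1) ^ i * real (2 * k choose (k + i)) * (f (x + real i * t) + f (x - real i * t))))"
proof -
  define g where "g j = (- 1) ^ j * real (2*k choose j) * f (x + (real j - real k) * t)" for j
  have "g (k + i) + g (k - i) = (-1) ^ k * ((-1) ^ i * real (2 * k choose (k + i)) *
          (f (x + real i * t) + f (x - real i * t)))" if "i \<in> {1..k}" for i
  proof -
    have "(-1::real) ^ (k - i) = (-1) ^ (k + i)"
      using that by (intro minus_one_power_iff[THEN trans]) (auto simp: minus_one_power_iff)
    moreover have "(2 * k choose (k - i)) = (2 * k choose (k + i))"
      using that binomial_symmetric[of "k + i" "2 * k"] by simp
    ultimately show ?thesis
      using that by (simp add: g_def of_nat_diff power_add algebra_simps)
  qed
  then have "(\<Sum>j=0..2*k. g j) = g k + (\<Sum>i=1..k. (-1) ^ k * ((-1) ^ i * real (2 * k choose (k + i)) *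
          (f (x + real i * t) + f (x - real i * t))))"
    by (simp add: sum_symmetric)
  then show ?thesis
    by (simp add: symm_diff_def g_def sum_distrib_left algebra_simps)
qed

text \<open>Since 1/(z+i) + 1/(z-i) = -2z/(i^2 - z^2), multiplication by \<open>z\<close> gives the
  central coefficient plus 2z^2 times an alternating sum of decreasing nonnegative terms that starts
  with a plus sign.\<close>

lemma alternating_binomial_reciprocal_bound:
  fixes z :: real
  assumes "z \<noteq> 0" "\<bar>z\<bar> < 1"
  shows "real (2 * k choose k) \<le> z * (real (2 * k choose k) / z +
     (\<Sum>i=1..k. (-1) ^ i * real (2 * k choose (k + i)) * (1 / (z + real i) + 1 / (z - real i))))"
proof -
  \<comment> \<open>The index shift absorbs the minus sign of the partial fractions. Numerators
    decrease and denominators increase with \<open>i\<close>.\<close>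
  define b where "b i = real (2 * k choose (k + Suc i)) / (real (Suc i) ^ 2 - z ^ 2)" for i
  have pos: "0 < real (Suc i) ^ 2 - z ^ 2" for i
    using assms power_strict_mono[of "\<bar>z\<bar>" "real (Suc i)" 2] by simp
  have "b (Suc i) \<le> b i" for i
    unfolding b_def
    by (intro frac_le) (use pos[of i] binomial_central_antimono[of k "Suc i"] in auto)
  moreover have "0 \<le> b i" for i
    using pos[of i] by (simp add: b_def)
  ultimately have "0 \<le> (\<Sum>i<k. (-1) ^ i * b i)"
    using alternating_sum_bounds by blast
  moreover have "(\<Sum>i=1..k. (-1) ^ i * real (2 * k choose (k + i)) * (1 / (z + real i) + 1 / (z - real i)))
      = (\<Sum>i<k. 2 * z * ((-1) ^ i * b i))"
  proof (rule sum.reindex_bij_witness[of _ Suc "\<lambda>i. i - 1"])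
    fix i assume i: "i \<in> {1..k}"
    then have "z - real i \<noteq> 0" "z + real i \<noteq> 0" "real i ^ 2 - z ^ 2 \<noteq> 0"
      using assms pos[of "i - 1"] by auto
    then have "1 / (z + real i) + 1 / (z - real i) = - (2 * z / (real i ^ 2 - z ^ 2))"
      by (simp add: field_simps power2_eq_square)
    moreover have "(-1::real) ^ i = - ((-1) ^ (i - 1))"
      using i by (cases i) auto
    ultimately show "2 * z * ((-1) ^ (i - 1) * b (i - 1)) =
        (-1) ^ i * real (2 * k choose (k + i)) * (1 / (z + real i) + 1 / (z - real i))"
      using i by (simp add: b_def)
  qed auto
  moreover have "z * (\<Sum>i<k. 2 * z * ((-1) ^ i * b i)) = 2 * z\<^sup>2 * (\<Sum>i<k. (-1) ^ i * b i)"
    by (simp add: sum_distrib_left power2_eq_square mult_ac)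
  ultimately show ?thesis
    using assms by (simp add: distrib_left)
qed

section \<open>The primitive and its zeros on the lattice\<close>

text \<open>An oriented integral from 0. For negative \<open>x\<close> the interval
  \<open>{0..x}\<close> is empty, hence the second branch. The base point 0 belongs to every lattice
  h Z.\<close>

definition primitive :: "(real \<Rightarrow> real) \<Rightarrow> real \<Rightarrow> real" where
  "primitive f x = (if 0 \<le> x then integral {0..x} f else - integral {x..0} f)"

lemma primitive_0 [simp]: "primitive f 0 = 0"
  by (simp add: primitive_def)

lemma integral_eq_primitive_diff:
  assumes f: "\<And>a b. f integrable_on {a..b::real}" and "a \<le> b"
  shows "integral {a..b} f = primitive f b - primitive f a"
proof -
  have "integral {a..c} f + integral {c..b} f = integral {a..b} f" if "a \<le> c" "c \<le> b" for a b c
    using Henstock_Kurzweil_Integration.integral_combine[OF that f] .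
  \<comment> \<open>The three instances place 0 to the left of, inside and to the right of the
    interval.\<close>
  from this[of 0 a b] this[of a 0 b] this[of a b 0] show ?thesis
    using \<open>a \<le> b\<close> by (cases "a = 0"; cases "b = 0") (auto simp: primitive_def)
qed

text \<open>For negative \<open>c\<close>, ordering the endpoints and passing to |c| each change the
  sign, so the quotient keeps its form. This covers nodes that move to the left as well.\<close>

lemma has_integral_primitive_affine:
  assumes f: "\<And>a b. f integrable_on {a..b::real}" and "c \<noteq> 0"
  shows "((\<lambda>s. f (a + c * s)) has_integral (primitive f (a + c) - primitive f a) / c) {0..1}"
proof -
  define u v where "u = min a (a + c)" and "v = max a (a + c)"
  have "(f has_integral (primitive f v - primitive f u)) (cbox u v)"
    using integrable_integral[OF f[of u v]] integral_eq_primitive_diff[OF f, of u v]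
    by (simp add: u_def v_def)
  from has_integral_affinity[OF this \<open>c \<noteq> 0\<close>, of a]
  have "((\<lambda>s. f (c * s + a)) has_integral (primitive f v - primitive f u) / \<bar>c\<bar>)
      ((\<lambda>x. (1 / c) *\<^sub>R x + - ((1 / c) *\<^sub>R a)) ` cbox u v)"
    by (simp add: field_simps)
  moreover have "(\<lambda>x. (1 / c) *\<^sub>R x + - ((1 / c) *\<^sub>R a)) ` cbox u v = {0..1}"
    using \<open>c \<noteq> 0\<close> by (subst image_affinity_cbox) (auto simp: u_def v_def min_def max_def field_simps)
  moreover have "(primitive f v - primitive f u) / \<bar>c\<bar> = (primitive f (a + c) - primitive f a) / c"
    using \<open>c \<noteq> 0\<close> by (auto simp: u_def v_def min_def max_def field_simps)
  ultimately show ?thesis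
    by (simp add: add.commute)
qed

lemma locally_integrable_imp_integrable_on:
  assumes "locally_integrable f"
  shows "f integrable_on {a..b}"
  using assms set_lebesgue_integral_eq_integral(1)[of "{a..b}" f]
  by (simp add: locally_integrable_def)

lemma primitive_lattice:
  assumes f: "locally_integrable f" and "zero_means f h" "0 < h"
  shows "primitive f (of_int n * h) = 0"
proof -
  have step: "primitive f ((of_int n + 1) * h) = primitive f (of_int n * h)" for n
  proof -
    have "of_int n * h \<le> (of_int n + 1) * h"
      using \<open>0 < h\<close> by simp
    moreover have "integral {of_int n * h..(of_int n + 1) * h} f = 0"
      using assms set_lebesgue_integral_eq_integral(2)[of "{of_int n * h..(of_int n + 1) * h}" f]
      by (simp add: locally_integrable_def zero_means_def)
    ultimately show ?thesis
      using integral_eq_primitive_diff[of f "of_int n * h" "(of_int n + 1) * h"]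
        locally_integrable_imp_integrable_on[OF f] by simp
  qed
  show ?thesis
  proof (induction n rule: int_induct[of _ 0])
    case (step1 n)
    then show ?case using step[of n] by simp
  next
    case (step2 n)
    then show ?case using step[of "n - 1"] by simp
  qed simp
qed

section \<open>Bounds for the primitive\<close>

lemma has_integral_unit_interval_bound:
  fixes g :: "real \<Rightarrow> real"
  assumes "(g has_integral I) {0..1}" and "\<And>s. s \<in> {0..1} \<Longrightarrow> \<bar>g s\<bar> \<le> M"
  shows "\<bar>I\<bar> \<le> M"
proof -
  have "0 \<le> M"
    using assms(2)[of 0] by simp
  then show ?thesis
    using has_integral_bound[of M g I 0 1] assms by simp
qed

text \<open>Along the segment \<open>s \<mapsto> (p h + s z h, (1 - s) h)\<close> in the plane of centres and steps,
  every node of the difference starts at a lattice point and ends at \<open>(p + z) h\<close>. Hence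
  all the integrals are multiples of the same value of the primitive.\<close>

lemma primitive_bound_aux:
  assumes f: "locally_integrable f" "zero_means f h" "0 < h"
    and M: "\<And>x t. \<bar>t\<bar> \<le> h \<Longrightarrow> \<bar>symm_diff (2 * k) t f x\<bar> \<le> M"
    and z: "z \<noteq> 0" "\<bar>z\<bar> < 1"
  shows "real (2 * k choose k) * \<bar>primitive f ((of_int p + z) * h)\<bar> \<le> M * h * \<bar>z\<bar>"
proof -
  define P where "P = primitive f ((of_int p + z) * h)"
  \<comment> \<open>Up to sign, \<open>R\<close> is the factor of \<open>P / h\<close> in the
    integral of the difference along the segment.\<close>
  define R where "R = real (2 * k choose k) / z +
     (\<Sum>i=1..k. (-1) ^ i * real (2 * k choose (k + i)) * (1 / (z + real i) + 1 / (z - real i)))"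
  note int = locally_integrable_imp_integrable_on[OF f(1)]
  \<comment> \<open>The primitive vanishes at the starting point (p+i)h, so the integral is
    \<open>P\<close> divided by the displacement (z-i)h.\<close>
  have node: "((\<lambda>s. f (of_int p * h + z * h * s + of_int i * (h * (1 - s)))) has_integral
      P / h * (1 / (z - of_int i))) {0..1}" if "z - of_int i \<noteq> 0" for i :: int
  proof -
    have "((\<lambda>s. f (of_int (p + i) * h + ((z - of_int i) * h) * s)) has_integral
        (primitive f (of_int (p + i) * h + (z - of_int i) * h) - primitive f (of_int (p + i) * h))
          / ((z - of_int i) * h)) {0..1}"
      using that f(3) by (intro has_integral_primitive_affine int) auto
    moreover have "of_int (p + i) * h + (z - of_int i) * h = (of_int p + z) * h"
      by (simp add: algebra_simps)
    moreover have "of_int (p + i) * h + ((z - of_int i) * h) * s =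
        of_int p * h + z * h * s + of_int i * (h * (1 - s))" for s
      by (simp add: algebra_simps)
    ultimately show ?thesis
      using primitive_lattice[OF f, of "p + i"] by (simp add: P_def field_simps)
  qed
  have nz: "z - real i \<noteq> 0" "z + real i \<noteq> 0" if "i \<in> {1..k}" for i
    using that z by auto
  have "((\<lambda>s. symm_diff (2 * k) (h * (1 - s)) f (of_int p * h + z * h * s)) has_integral
      (-1) ^ k * (real (2 * k choose k) * (P / h * (1 / z)) +
        (\<Sum>i=1..k. (-1) ^ i * real (2 * k choose (k + i)) *
          (P / h * (1 / (z - real i)) + P / h * (1 / (z + real i)))))) {0..1}"
    unfolding symm_diff_even
    by (intro has_integral_mult_right has_integral_add has_integral_sum finite_atLeastAtMost)
      (use node[of 0] node[of "int i" for i] node[of "- int i" for i] nz z in auto)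
  moreover have "(-1) ^ k * (real (2 * k choose k) * (P / h * (1 / z)) +
        (\<Sum>i=1..k. (-1) ^ i * real (2 * k choose (k + i)) *
          (P / h * (1 / (z - real i)) + P / h * (1 / (z + real i))))) = (-1) ^ k * (P / h * R)"
    by (simp add: R_def sum_distrib_left algebra_simps)
  \<comment> \<open>The step \<open>h * (1 - s)\<close> stays between 0 and \<open>h\<close>, so
    \<open>M\<close> bounds the integrand.\<close>
  ultimately have "\<bar>(-1) ^ k * (P / h * R)\<bar> \<le> M"
    by (elim has_integral_unit_interval_bound[OF back_subst[of "\<lambda>I. (_ has_integral I) {0..1}"]])
      (use f(3) in \<open>auto intro!: M simp: abs_mult mult_left_le\<close>)
  then have PR: "\<bar>P\<bar> * \<bar>R\<bar> \<le> M * h"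
    using f(3) by (simp add: abs_mult field_simps)
  have "real (2 * k choose k) \<le> z * R"
    unfolding R_def by (rule alternating_binomial_reciprocal_bound[OF z])
  then have "real (2 * k choose k) * \<bar>P\<bar> \<le> \<bar>z * R\<bar> * \<bar>P\<bar>"
    by (intro mult_right_mono) auto
  also have "\<dots> = \<bar>P\<bar> * \<bar>R\<bar> * \<bar>z\<bar>"
    by (simp add: abs_mult)
  also have "\<dots> \<le> M * h * \<bar>z\<bar>"
    by (intro mult_right_mono PR) auto
  finally show ?thesis
    by (simp add: P_def)
qed

text \<open>The offset in \<open>primitive_bound_aux\<close> is measured from the nearest lattice
  point, which makes it at most 1/2 in absolute value. Offset 0 is treated apart, because the
  reciprocals there divide by it.\<close>

lemma primitive_bound:
  assumes f: "locally_integrable f" "zero_means f h" "0 < h"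
    and M: "\<And>x t. \<bar>t\<bar> \<le> h \<Longrightarrow> \<bar>symm_diff (2 * k) t f x\<bar> \<le> M"
  shows "real (2 * k choose k) * \<bar>primitive f x\<bar> \<le> M * h / 2"
proof -
  define p where "p = \<lfloor>x / h\<rfloor>"
  define z where "z = x / h - of_int p"
  have x: "x = (of_int p + z) * h" and z: "0 \<le> z" "z < 1"
    using f(3) by (auto simp: z_def p_def) linarith
  have "0 \<le> M"
    using M[of 0 0] f(3) by simp
  have half: "M * h * w \<le> M * h / 2" if "w \<le> 1/2" for w
    using mult_left_mono[OF that, of "M * h"] \<open>0 \<le> M\<close> f(3) by simp
  consider "z = 0" | "0 < z" "z \<le> 1/2" | "1/2 < z"
    using z by linarith
  then show ?thesis
  proof cases
    case 1
    then show ?thesis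
      using primitive_lattice[OF f, of p] x \<open>0 \<le> M\<close> f(3) by simp
  next
    case 2
    then show ?thesis
      using primitive_bound_aux[OF f M, where z = z and p = p] z x half[of "\<bar>z\<bar>"] by auto
  next
    case 3
    then show ?thesis
      using primitive_bound_aux[OF f M, where z = "z - 1" and p = "p + 1"] z x half[of "\<bar>z - 1\<bar>"] by auto
  qed
qed

section \<open>The upper bound for the Whitney constant\<close>

text \<open>With steps \<open>h * s\<close> the central term stays constant under averaging, while
  the pair at distance \<open>i\<close> contributes at most M/i. Summing over \<open>i\<close>
  produces the harmonic number.\<close>

lemma pointwise_bound:
  assumes f: "locally_integrable f" "zero_means f h" "0 < h"
    and M: "\<And>x t. \<bar>t\<bar> \<le> h \<Longrightarrow> \<bar>symm_diff (2 * k) t f x\<bar> \<le> M"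
  shows "real (2 * k choose k) * \<bar>f x\<bar> \<le> (1 + harm k) * M"
proof -
  define C where "C = real (2 * k choose k)"
  define S where "S = (\<Sum>i=1..k. (-1) ^ i * real (2 * k choose (k + i)) *
    ((primitive f (x + real i * h) - primitive f (x - real i * h)) / (real i * h)))"
  have "0 \<le> M"
    using M[of 0 0] f(3) by simp
  note int = locally_integrable_imp_integrable_on[OF f(1)]
  have node: "((\<lambda>s. f (x + of_int i * (h * s))) has_integral
      (primitive f (x + of_int i * h) - primitive f x) / (of_int i * h)) {0..1}" if "i \<noteq> 0" for i :: int
    using has_integral_primitive_affine[OF int, of "of_int i * h" x] that f(3) by (simp add: mult.assoc)
  \<comment> \<open>The two divisors have opposite signs, so \<open>primitive f x\<close>
    cancels.\<close>
  have pair: "((\<lambda>s. f (x + real i * (h * s)) + f (x - real i * (h * s))) has_integral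
      (primitive f (x + real i * h) - primitive f (x - real i * h)) / (real i * h)) {0..1}"
    if "i \<in> {1..k}" for i
    using has_integral_add[OF node[of "int i"] node[of "- int i"]] that
    by (simp add: diff_divide_distrib)
  have "((\<lambda>s. symm_diff (2 * k) (h * s) f x) has_integral (-1) ^ k * (C * f x + S)) {0..1}"
    unfolding symm_diff_even S_def C_def
    by (intro has_integral_mult_right has_integral_add has_integral_sum finite_atLeastAtMost pair)
      (use has_integral_const_real[of "f x" 0 1] in auto)
  then have "\<bar>(-1) ^ k * (C * f x + S)\<bar> \<le> M"
    by (rule has_integral_unit_interval_bound)
      (use f(3) in \<open>auto intro!: M simp: abs_mult mult_left_le\<close>)
  then have "\<bar>C * f x + S\<bar> \<le> M"
    by (simp add: abs_mult)
  moreover have "\<bar>S\<bar> \<le> (\<Sum>i=1..k. M * inverse (real i))"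
    unfolding S_def
  proof (rule order.trans[OF sum_abs], rule sum_mono)
    fix i :: nat assume i: "i \<in> {1..k}"
    define D where "D = primitive f (x + real i * h) - primitive f (x - real i * h)"
    \<comment> \<open>Raising the coefficient to the central one lets \<open>primitive_bound\<close>
      apply at both endpoints, each giving half of \<open>M * h\<close>.\<close>
    have "real (2 * k choose (k + i)) * \<bar>D\<bar> \<le> C * \<bar>D\<bar>"
      unfolding C_def by (intro mult_right_mono of_nat_mono binomial_maximum') auto
    also have "\<dots> \<le> C * (\<bar>primitive f (x + real i * h)\<bar> + \<bar>primitive f (x - real i * h)\<bar>)"
      by (intro mult_left_mono) (auto simp: D_def C_def)
    also have "\<dots> \<le> M * h"
      using primitive_bound[OF f M, where x = "x + real i * h"]
        primitive_bound[OF f M, where x = "x - real i * h"]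
      by (simp add: C_def ring_distribs)
    finally have "real (2 * k choose (k + i)) * \<bar>D\<bar> / (real i * h) \<le> M * h / (real i * h)"
      using f(3) by (intro divide_right_mono) auto
    also have "M * h / (real i * h) = M * inverse (real i)"
      using f(3) by (simp add: divide_inverse)
    finally have "real (2 * k choose (k + i)) * \<bar>D\<bar> / (real i * h) \<le> M * inverse (real i)" .
    then show "\<bar>(-1) ^ i * real (2 * k choose (k + i)) *
        ((primitive f (x + real i * h) - primitive f (x - real i * h)) / (real i * h))\<bar>
        \<le> M * inverse (real i)"
      using f(3) by (simp add: D_def[symmetric] abs_mult)
  qed
  moreover have "(\<Sum>i=1..k. M * inverse (real i)) = harm k * M"
    by (simp add: harm_def mult.commute flip: sum_distrib_left)
  ultimately have "\<bar>C * f x\<bar> \<le> (1 + harm k) * M"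
    by (simp add: ring_distribs)
  then show ?thesis
    by (simp add: C_def abs_mult)
qed

lemma modulus_of_smoothness_upper:
  assumes "\<bar>t\<bar> \<le> h"
  shows "ennreal \<bar>symm_diff m t f x\<bar> \<le> modulus_of_smoothness m f h"
  unfolding modulus_of_smoothness_def sup_norm_def
  by (rule SUP_upper2[of t]) (use assms in \<open>auto intro: SUP_upper\<close>)

lemma Whitney_constant_harm:
  "Whitney_constant k ((1 + harm k) / real (2 * k choose k))"
  unfolding Whitney_constant_def
proof (intro conjI allI impI)
  have C: "0 < real (2 * k choose k)"
    by simp
  have H: "(0::real) \<le> harm k"
    by (rule harm_nonneg)
  show W: "0 < (1 + harm k) / real (2 * k choose k)"
    using C H by (intro divide_pos_pos) auto
  fix h f assume f: "0 < h \<and> locally_integrable f \<and> zero_means f h"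
  show "sup_norm f \<le> ennreal ((1 + harm k) / real (2 * k choose k)) * modulus_of_smoothness (2 * k) f h"
  proof (cases "modulus_of_smoothness (2 * k) f h")
    case (real M)
    have "\<bar>symm_diff (2 * k) t f x\<bar> \<le> M" if "\<bar>t\<bar> \<le> h" for x t
      using modulus_of_smoothness_upper[OF that, of "2 * k" f x] real by simp
    then have "real (2 * k choose k) * \<bar>f x\<bar> \<le> (1 + harm k) * M" for x
      using f by (intro pointwise_bound) auto
    then have "\<bar>f x\<bar> \<le> (1 + harm k) / real (2 * k choose k) * M" for x
      using C by (simp add: field_simps)
    then show ?thesis
      unfolding sup_norm_def real(2) using real(1) W
      by (intro SUP_least) (simp add: ennreal_leI flip: ennreal_mult)
  next
    case top
    \<comment> \<open>In \<open>ennreal\<close> the product of 0 and infinity is 0, so the factor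
      must be nonzero for the right side to be infinite.\<close>
    have "ennreal ((1 + harm k) / real (2 * k choose k)) \<noteq> 0"
      using W by (simp only: ennreal_eq_0_iff not_le)
    then show ?thesis
      using top by (simp add: ennreal_mult_top)
  qed
qed

section \<open>The lower bound from a point spike\<close>

text \<open>A spike of height 1 has zero integrals, and a difference with nonzero step meets it in
  at most one node. Its modulus is therefore at most the largest coefficient, which is the central
  one.\<close>

lemma Whitney_constant_lower:
  assumes "1 \<le> k" and W: "Whitney_constant k W"
  shows "1 / real (2 * k choose k) \<le> W"
proof -
  define f :: "real \<Rightarrow> real" where "f = indicator {0}"
  have f_cut: "(\<lambda>x. indicator K x *\<^sub>R f x) = indicator (K \<inter> {0})" for K
    by (auto simp: f_def indicator_def)
  have sets: "K \<inter> {0} \<in> sets lebesgue" and null: "emeasure lebesgue (K \<inter> {0}) = 0" for K :: "real set"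
    by (cases "0 \<in> K"; simp)+
  have "locally_integrable f"
    unfolding locally_integrable_def set_integrable_def f_cut
    using sets null by (intro allI impI integrable_real_indicator) auto
  moreover have "zero_means f 1"
    unfolding zero_means_def set_lebesgue_integral_def f_cut
    using null by (simp add: measure_def)
  ultimately have le: "sup_norm f \<le> ennreal W * modulus_of_smoothness (2 * k) f 1"
    using W by (auto simp: Whitney_constant_def)
  have "\<bar>symm_diff (2 * k) t f x\<bar> \<le> real (2 * k choose k)" for t x
  proof (cases "t = 0")
    case True
    \<comment> \<open>At step 0 all nodes coincide and the difference is a multiple of this sum,
      which vanishes because k is positive.\<close>
    have "(\<Sum>j=0..2*k. (- 1) ^ j * real (2 * k choose j)) = 0"
      using choose_alternating_sum[of "2 * k", where ?'a = real] assms(1) by (simp add: atLeast0AtMost)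
    then show ?thesis
      using True by (simp add: symm_diff_def flip: sum_distrib_right)
  next
    case False
    \<comment> \<open>The indices of the nodes that hit the spike.\<close>
    define A where "A = {j \<in> {0..2*k}. x + (real j - real (2 * k) / 2) * t = 0}"
    have "symm_diff (2 * k) t f x = (\<Sum>j\<in>A. (- 1) ^ j * real (2 * k choose j))"
      unfolding symm_diff_def A_def by (rule sum.mono_neutral_cong_right) (auto simp: f_def indicator_def)
    moreover have "j = j'" if "j \<in> A" "j' \<in> A" for j j'
    proof -
      have "(real j - real (2 * k) / 2) * t = (real j' - real (2 * k) / 2) * t"
        using that unfolding A_def by (simp only: mem_Collect_eq) linarith
      then show ?thesis using False by simp
    qed
    then have "A = {} \<or> (\<exists>j. A = {j})"
      by blast
    ultimately show ?thesis
      using binomial_maximum'[of k] by (auto simp: abs_mult)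
  qed
  then have "modulus_of_smoothness (2 * k) f 1 \<le> ennreal (real (2 * k choose k))"
    unfolding modulus_of_smoothness_def sup_norm_def by (intro SUP_least ennreal_leI)
  then have "ennreal W * modulus_of_smoothness (2 * k) f 1 \<le> ennreal W * ennreal (real (2 * k choose k))"
    by (rule mult_left_mono) simp
  moreover have "ennreal 1 \<le> sup_norm f"
    unfolding sup_norm_def by (rule SUP_upper2[of 0]) (auto simp: f_def)
  ultimately have "ennreal 1 \<le> ennreal (W * real (2 * k choose k))"
    using le W by (simp add: ennreal_mult Whitney_constant_def)
  then have "1 \<le> W * real (2 * k choose k)"
    using W by (subst (asm) ennreal_le_iff) (auto simp: Whitney_constant_def)
  then show ?thesis
    by (simp add: field_simps)
qed

section \<open>Attainment of the best constant\<close>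

text \<open>For fixed \<open>f\<close>, \<open>h\<close> and \<open>x\<close> with finite modulus M,
  the condition |f x| \<le> W M is closed in \<open>W\<close> and so passes to the infimum. The
  lower bound keeps the infimum positive.\<close>

lemma Whitney_constant_Inf:
  assumes "1 \<le> k"
  shows "Whitney_constant k (Inf {W. Whitney_constant k W})"
  unfolding Whitney_constant_def[of k "Inf _"]
proof (intro conjI allI impI)
  define A where "A = {W. Whitney_constant k W}"
  have ne: "A \<noteq> {}"
    using Whitney_constant_harm by (auto simp: A_def)
  have "1 / real (2 * k choose k) \<le> Inf A"
    using Whitney_constant_lower[OF assms] by (intro cInf_greatest[OF ne]) (auto simp: A_def)
  moreover have "0 < 1 / real (2 * k choose k)"
    by simp
  ultimately show pos: "0 < Inf {W. Whitney_constant k W}"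
    unfolding A_def by linarith
  fix h f assume f: "0 < h \<and> locally_integrable f \<and> zero_means f h"
  show "sup_norm f \<le> ennreal (Inf {W. Whitney_constant k W}) * modulus_of_smoothness (2 * k) f h"
  proof (cases "modulus_of_smoothness (2 * k) f h")
    case (real M)
    have "\<bar>f x\<bar> \<le> Inf A * M" for x
    proof -
      have le: "\<bar>f x\<bar> \<le> W * M" if "W \<in> A" for W
      proof -
        have "0 < W" and "sup_norm f \<le> ennreal W * ennreal M"
          using that f by (auto simp: A_def Whitney_constant_def real(2)[symmetric])
        moreover have "ennreal \<bar>f x\<bar> \<le> sup_norm f"
          unfolding sup_norm_def by (rule SUP_upper) simp
        ultimately have "ennreal \<bar>f x\<bar> \<le> ennreal (W * M)"
          using real(1) by (simp add: ennreal_mult)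
        then show ?thesis
          using \<open>0 < W\<close> real(1) by simp
      qed
      show ?thesis
      \<comment> \<open>For positive \<open>M\<close>, |f x| / M is a lower bound of
        \<open>A\<close>. For \<open>M = 0\<close> any single element of \<open>A\<close> already
        forces f x = 0.\<close>
      proof (cases "M = 0")
        case True
        then show ?thesis using le ne by auto
      next
        case False
        then have "0 < M" using real(1) by simp
        then have "\<bar>f x\<bar> / M \<le> Inf A"
          using le by (intro cInf_greatest[OF ne]) (simp add: field_simps)
        then show ?thesis
          using \<open>0 < M\<close> by (simp add: field_simps)
      qed
    qed
    then show ?thesis
      unfolding sup_norm_def real(2) using real(1) pos
      by (intro SUP_least) (simp add: A_def ennreal_leI flip: ennreal_mult)
  next
    case top
    then show ?thesis
      using pos by (simp add: ennreal_mult_top)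
  qed
qed

theorem theorem1:
  fixes k :: nat
  assumes "k \<ge> 1"
  shows "(\<forall>(f :: real \<Rightarrow> real) (h :: real).
            locally_integrable f \<and> h > 0 \<and> zero_means f h \<longrightarrow>
            sup_norm f \<le> ennreal (best_Whitney_constant k) * modulus_of_smoothness (2 * k) f h) \<and>
         (\<forall>W. Whitney_constant k W \<longrightarrow> best_Whitney_constant k \<le> W) \<and>
         1 / real (2 * k choose k) \<le> best_Whitney_constant k \<and>
         best_Whitney_constant k \<le> (1 + harm k) / real (2 * k choose k)"
proof -
  define I where "I = Inf {W. Whitney_constant k W}"
  have I: "Whitney_constant k I"
    unfolding I_def by (rule Whitney_constant_Inf[OF assms])
  have least: "I \<le> W" if "Whitney_constant k W" for W
    unfolding I_def
    by (rule cInf_lower) (use that Whitney_constant_lower[OF assms] in \<open>auto intro!: bdd_belowI[of _ "1 / real (2 * k choose k)"]\<close>)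
  \<comment> \<open>Because the infimum is attained, \<open>LEAST\<close> denotes it.\<close>
  have "best_Whitney_constant k = I"
    unfolding best_Whitney_constant_def using I least by (rule Least_equality)
  then show ?thesis
    using I least Whitney_constant_harm[of k] Whitney_constant_lower[OF assms I]
    by (auto simp: Whitney_constant_def)
qed

end
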